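(* Let $Q$ be a prime power, let $d$ be a positive integer, and let $\beta$ be a $(Q+1)$-th root of unity in $\mathbb{F}_{Q^2}$ (that is, $\beta\in\mathbb{F}_{Q^2}$ and $\beta^{Q+1}=1$). Then $\beta x^{1+d(Q-1)}$ is a complete permutation polynomial over $\mathbb{F}_{Q^2}$ if and only if both of the following hold: (1) $\gcd\bigl((d-1)(2d-1),\,Q+1\bigr)=1$; and (2) $(-\beta)^{(Q+1)/\gcd(Q+1,d)}\ne 1$.
   Context: For a prime power $q$, $\mathbb{F}_q$ denotes the finite field with $q$ elements. A polynomial is a permutation polynomial over $\mathbb{F}_q$ if it induces a bijection from $\mathbb{F}_q$ to itself. A complete permutation polynomial over $\mathbb{F}_q$ is a polynomial $f(x)\in\mathbb{F}_q[x]$ such that both $f(x)$ and $f(x)+x$ are permutation polynomials over $\mathbb{F}_q$. *)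

theory Defs
  imports
    "HOL-Computational_Algebra.Polynomial"
    "HOL-Number_Theory.Prime_Powers"
    "HOL-Library.Cardinality"
begin

definition permutation_poly :: "'a::{field,finite} poly \<Rightarrow> bool" where
  "permutation_poly f \<longleftrightarrow> bij (poly f)"

definition complete_permutation_poly :: "'a::{field,finite} poly \<Rightarrow> bool" where
  "complete_permutation_poly f \<longleftrightarrow> permutation_poly f \<and> permutation_poly (f + [:0, 1:])"

end

theory Submission
  imports "HOL-Algebra.Algebraic_Closure_Type" "HOL-Number_Theory.Residues" Defs
begin

text \<open>
  On the group \<open>\<mu>\<close> of \<open>(Q + 1)\<close>-th roots of unity, \<open>y ^ Q\<close> is the inverse of \<open>y\<close>. A map of the
  form \<open>x * h (x ^ (Q - 1))\<close> permutes the field iff \<open>h\<close> has no zero in \<open>\<mu>\<close> and \<open>y * h y ^ (Q - 1)\<close>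
  is injective on \<open>\<mu>\<close>. For \<open>h y = \<beta> * y ^ d\<close> the latter map is a constant times \<open>y ^ (1 - 2 * d)\<close>;
  for \<open>h y = \<beta> * y ^ d + 1\<close> it is, by the Frobenius map, a constant times \<open>y ^ (1 - d)\<close>.
  Since \<open>\<mu>\<close> is cyclic of order \<open>Q + 1\<close>, injectivity of these monomials is a coprimality condition,
  and \<open>h\<close> has a zero iff \<open>- \<beta>\<close> is a \<open>d\<close>-th power in \<open>\<mu>\<close>.
\<close>

section \<open>Roots of unity in a finite field\<close>

lemma power_eq_if_cong:
  fixes y :: "'a::monoid_mult"
  assumes "y ^ n = 1" and "[a = b] (mod n)"
  shows "y ^ a = y ^ b"
proof -
  have mod: "y ^ c = y ^ (c mod n)" for c
  proof -
    have "y ^ c = y ^ (n * (c div n) + c mod n)" by simp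
    also have "\<dots> = y ^ (c mod n)"
      unfolding power_add power_mult using assms(1) by simp
    finally show ?thesis .
  qed
  show ?thesis using mod[of a] mod[of b] assms(2) by (simp add: cong_def)
qed

text \<open>That a generator exists is the theorem of HOL-Algebra on the multiplicative group of a
  finite field, carried over to the type; its exact order then follows by counting.\<close>

lemma finite_field_primitive_element:
  obtains g :: "'a::{field,finite}"
  where "\<And>x. x \<noteq> 0 \<Longrightarrow> \<exists>i. x = g ^ i"
    and "\<And>j. g ^ j = 1 \<longleftrightarrow> CARD('a) - 1 dvd j"
proof -
  define R where "R = (ring_of_type_algebra :: 'a ring)"
  interpret R: field R unfolding R_def by rule
  have pow: "x [^]\<^bsub>R\<^esub> (i::nat) = x ^ i" for x i
    by (induction i) (simp_all add: R_def ring_of_type_algebra_def nat_pow_def mult.commute)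
  have carrier: "carrier (mult_of R) = UNIV - {0}"
    by (simp add: R_def ring_of_type_algebra_def)
  obtain g where g: "g \<in> carrier (mult_of R)"
      "carrier (mult_of R) = {g [^]\<^bsub>R\<^esub> i | i::nat. i \<in> UNIV}"
    using R.finite_field_mult_group_has_gen by auto
  have g0: "g \<noteq> 0" using g(1) unfolding carrier by simp
  have gen: "\<exists>i. x = g ^ i" if "x \<noteq> 0" for x
  proof -
    have "x \<in> carrier (mult_of R)" using that carrier by simp
    then show ?thesis unfolding g(2) pow by blast
  qed
  define N where "N = CARD('a) - 1"
  have cardN: "card (UNIV - {0 :: 'a}) = N" unfolding N_def by (simp add: card_Diff_singleton)
  \<comment> \<open>If \<open>g ^ j = 1\<close>, then the at most \<open>j\<close> powers below
    exponent \<open>j\<close> must cover all \<open>N\<close> nonzero elements.\<close>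
  have ge: "N \<le> j" if "j > 0" "g ^ j = 1" for j
  proof -
    have "UNIV - {0} \<subseteq> (\<lambda>i. g ^ i) ` {..<j}"
    proof
      fix x :: 'a assume "x \<in> UNIV - {0}"
      then obtain i where "x = g ^ i" using gen by blast
      also have "\<dots> = g ^ (i mod j)"
        by (rule power_eq_if_cong[OF that(2)]) (simp add: cong_def)
      finally show "x \<in> (\<lambda>i. g ^ i) ` {..<j}" using that(1) by simp
    qed
    then have "N \<le> card ((\<lambda>i. g ^ i) ` {..<j})"
      unfolding cardN[symmetric] by (intro card_mono) auto
    also have "\<dots> \<le> j" using card_image_le[of "{..<j}" "\<lambda>i. g ^ i"] by simp
    finally show ?thesis .
  qed
  \<comment> \<open>Pigeonhole: \<open>N + 1\<close> exponents meet only \<open>N\<close> nonzero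
    elements. The resulting \<open>b - a\<close> is at most \<open>N\<close>, and \<open>ge\<close>
    makes it equal to \<open>N\<close>.\<close>
  have "\<not> inj_on (\<lambda>i. g ^ i) {..N}"
  proof
    assume "inj_on (\<lambda>i. g ^ i) {..N}"
    then have "card {..N} \<le> card (UNIV - {0 :: 'a})"
      by (rule card_inj_on_le) (use g0 in auto)
    then show False unfolding cardN by simp
  qed
  then obtain a b where ab: "a < b" "b \<le> N" "g ^ a = g ^ b"
    unfolding inj_on_def by (metis atMost_iff linorder_neqE_nat)
  have "g ^ b = g ^ a * g ^ (b - a)" using ab(1) by (simp flip: power_add)
  then have "g ^ (b - a) = 1" using ab(3) g0 by simp
  moreover from this have "b - a = N" using ge[of "b - a"] ab by simp
  ultimately have gN: "g ^ N = 1" by simp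
  have "0 < N" using ab by simp
  have "g ^ j = 1 \<longleftrightarrow> N dvd j" for j
  proof
    assume "g ^ j = 1"
    then have "g ^ (j mod N) = 1"
      using power_eq_if_cong[OF gN, of "j mod N" j] by (simp add: cong_def)
    then have "\<not> j mod N > 0" using ge[of "j mod N"] \<open>0 < N\<close> by (meson leD mod_less_divisor)
    then show "N dvd j" by (simp add: dvd_eq_mod_eq_0)
  next
    assume "N dvd j"
    then show "g ^ j = 1" using gN by (auto simp: power_mult elim!: dvdE)
  qed
  then show thesis using that gen unfolding N_def by blast
qed

text \<open>Take \<open>z = g ^ m\<close> for a primitive element \<open>g\<close>: if
  \<open>(g ^ i) ^ n = 1\<close>, then \<open>m * n\<close> divides \<open>i * n\<close>, so
  \<open>m\<close> divides \<open>i\<close>. The last conclusion makes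
  \<open>x \<mapsto> x ^ m\<close> reach every \<open>n\<close>-th root of unity.\<close>

lemma roots_of_unity_generator:
  assumes "CARD('a::{field,finite}) - 1 = m * n" and "n > 0"
  obtains z :: "'a::{field,finite}"
  where "\<And>j. z ^ j = 1 \<longleftrightarrow> n dvd j"
    and "\<And>y. y ^ n = 1 \<Longrightarrow> \<exists>j. y = z ^ j"
    and "\<And>y :: 'a::{field,finite}. y ^ n = 1 \<Longrightarrow> \<exists>x. x \<noteq> 0 \<and> y = x ^ m"
proof -
  obtain g :: 'a where gen: "\<And>x. x \<noteq> 0 \<Longrightarrow> \<exists>i. x = g ^ i"
    and ord: "\<And>j. g ^ j = 1 \<longleftrightarrow> CARD('a) - 1 dvd j"
    using finite_field_primitive_element by blast
  have "CARD('a) > 1" using card_mono[of UNIV "{0, 1 :: 'a}"] by simp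
  then have "m > 0" using assms(1) by (cases m) auto
  have g0: "g \<noteq> 0" using ord[of "CARD('a) - 1"] \<open>CARD('a) > 1\<close> by (auto simp: power_0_left)
  have *: "\<exists>j. y = (g ^ m) ^ j" if "y ^ n = 1" for y :: 'a
  proof -
    have "y \<noteq> 0" using that assms(2) by (auto simp: power_0_left)
    then obtain i where i: "y = g ^ i" using gen by blast
    have "g ^ (i * n) = 1" using that i by (simp add: power_mult)
    then have "m dvd i" using ord assms by simp
    then show ?thesis using i by (auto simp: power_mult elim!: dvdE)
  qed
  show thesis
  proof (rule that[of "g ^ m"])
    show "(g ^ m) ^ j = 1 \<longleftrightarrow> n dvd j" for j
      using ord[of "m * j"] assms(1) \<open>m > 0\<close> by (simp add: power_mult)
    show "\<exists>j. y = (g ^ m) ^ j" if "y ^ n = 1" for y :: 'a using *[OF that] .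
    show "\<exists>x. x \<noteq> 0 \<and> y = x ^ m" if "y ^ n = 1" for y :: 'a
      using *[OF that] g0 by (metis power_mult mult.commute power_not_zero)
  qed
qed

lemma inj_on_power_roots_of_unity_iff:
  assumes "n dvd CARD('a::{field,finite}) - 1" and "n > 0"
  shows "inj_on (\<lambda>y :: 'a::{field,finite}. y ^ k) {y. y ^ n = 1} \<longleftrightarrow> coprime k n"
proof
  assume inj: "inj_on (\<lambda>y :: 'a. y ^ k) {y. y ^ n = 1}"
  obtain m where card: "CARD('a) - 1 = m * n" using assms(1) by (metis dvdE mult.commute)
  then obtain z :: 'a where z: "\<And>j. z ^ j = 1 \<longleftrightarrow> n dvd j"
    using roots_of_unity_generator[OF card assms(2)] by metis
  \<comment> \<open>\<open>z ^ e\<close> has order \<open>gcd k n\<close> and lies in the kernel of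
    the \<open>k\<close>-th power map, so injectivity forces this order to be 1.\<close>
  define e where "e = n div gcd k n"
  have ne: "n = e * gcd k n" unfolding e_def by simp
  have "n dvd e * k"
    by (subst ne, intro mult_dvd_mono) simp_all
  then have "(z ^ e) ^ k = 1" using z by (simp flip: power_mult)
  moreover have "(z ^ e) ^ n = 1" using z by (simp flip: power_mult)
  ultimately have "z ^ e = 1" using inj_onD[OF inj, of "z ^ e" 1] by simp
  then have "n dvd e" using z by simp
  moreover have "e > 0" using ne assms(2) by (cases e) auto
  ultimately have "n \<le> e" by (rule dvd_imp_le)
  then have "gcd k n = 1" using ne \<open>e > 0\<close> assms(2)
    by (metis e_def div_less_dividend gcd_pos_nat less_one linorder_neqE_nat not_less neq0_conv)
  then show "coprime k n" by (simp add: coprime_iff_gcd_eq_1)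
next
  assume "coprime k n"
  then obtain x where x: "[k * x = Suc 0] (mod n)" using cong_solve_coprime_nat by blast
  have "(y ^ k) ^ x = y" if "y ^ n = 1" for y :: 'a
    using power_eq_if_cong[OF that x] by (simp add: power_mult)
  then show "inj_on (\<lambda>y :: 'a. y ^ k) {y. y ^ n = 1}"
    by (intro inj_on_inverseI[where g = "\<lambda>y. y ^ x"]) simp
qed

text \<open>In a cyclic group of order \<open>n\<close>, the \<open>k\<close>-th powers form the
  subgroup generated by \<open>z ^ gcd n k\<close>, which is the kernel of raising to the power
  \<open>n div gcd n k\<close>.\<close>

lemma power_root_of_unity_iff:
  fixes u :: "'a::{field,finite}"
  assumes "n dvd CARD('a) - 1" and "n > 0" and "u ^ n = 1"
  shows "(\<exists>y. y ^ n = 1 \<and> y ^ k = u) \<longleftrightarrow> u ^ (n div gcd n k) = 1"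
proof
  assume "\<exists>y. y ^ n = 1 \<and> y ^ k = u"
  then obtain y where y: "y ^ n = 1" "u = y ^ k" by blast
  have "n dvd k * (n div gcd n k)"
    by (metis dvd_div_mult dvd_triv_right gcd_dvd1 gcd_dvd2 div_mult_swap)
  then obtain c where "k * (n div gcd n k) = n * c" by (rule dvdE)
  then show "u ^ (n div gcd n k) = 1"
    using y by (metis power_mult power_one)
next
  assume u: "u ^ (n div gcd n k) = 1"
  obtain m where card: "CARD('a) - 1 = m * n" using assms(1) by (metis dvdE mult.commute)
  then obtain z :: 'a where z: "\<And>j. z ^ j = 1 \<longleftrightarrow> n dvd j"
    and gen: "\<And>y. y ^ n = 1 \<Longrightarrow> \<exists>j. y = z ^ j"
    using roots_of_unity_generator[OF card assms(2)] by metis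
  obtain j where j: "u = z ^ j" using gen assms(3) by blast
  have "n dvd j * (n div gcd n k)" using u z j by (simp flip: power_mult)
  then have "gcd n k * (n div gcd n k) dvd j * (n div gcd n k)" by simp
  moreover have "n div gcd n k \<noteq> 0" using assms(2) by (simp add: dvd_div_eq_0_iff)
  ultimately have "gcd n k dvd j" by (metis dvd_times_right_cancel_iff)
  then obtain t where t: "j = gcd k n * t" by (metis dvdE gcd.commute)
  \<comment> \<open>By Bezout, \<open>z ^ x\<close> is a \<open>k\<close>-th root of
    \<open>z ^ gcd k n\<close>; its \<open>t\<close>-th power is then a \<open>k\<close>-th root of
    \<open>u\<close>.\<close>
  obtain x where x: "[k * x = gcd k n] (mod n)" using cong_solve_nat by blast
  have zn: "z ^ n = 1" using z by simp
  have "[x * t * k = j] (mod n)"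
    using cong_scalar_right[OF x, of t] t by (simp add: mult_ac)
  then have "(z ^ (x * t)) ^ k = u"
    using power_eq_if_cong[OF zn] j by (simp flip: power_mult)
  moreover have "(z ^ (x * t)) ^ n = 1" using z by (simp flip: power_mult)
  ultimately show "\<exists>y. y ^ n = 1 \<and> y ^ k = u" by blast
qed

section \<open>Permutations of the form \<open>x * h (x ^ m)\<close>\<close>

text \<open>
  The Akbary--Ghioca--Wang criterion: \<open>x \<mapsto> x ^ m\<close> semiconjugates \<open>x * h (x ^ m)\<close> to
  \<open>y * h y ^ m\<close>, and the former map is linear on each fibre of \<open>x \<mapsto> x ^ m\<close>.
\<close>

lemma inj_times_power_iff:
  fixes h :: "'a::{field,finite} \<Rightarrow> 'a"
  assumes card: "CARD('a) - 1 = m * n" and "m > 0" and "n > 0"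
  shows "inj (\<lambda>x. x * h (x ^ m)) \<longleftrightarrow>
    (\<forall>y. y ^ n = 1 \<longrightarrow> h y \<noteq> 0) \<and> inj_on (\<lambda>y. y * h y ^ m) {y. y ^ n = 1}"
    (is "inj ?f \<longleftrightarrow> ?nz \<and> inj_on ?g ?\<mu>")
proof -
  have surj: "\<exists>x. x \<noteq> 0 \<and> y = x ^ m" if "y ^ n = 1" for y :: 'a
    using roots_of_unity_generator[OF card \<open>n > 0\<close>] that by metis
  have ord: "(x ^ m) ^ n = 1" if "x \<noteq> 0" for x :: 'a
  proof -
    obtain g :: 'a where gen: "\<And>x. x \<noteq> 0 \<Longrightarrow> \<exists>i. x = g ^ i"
      and g: "\<And>j. g ^ j = 1 \<longleftrightarrow> CARD('a) - 1 dvd j"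
      using finite_field_primitive_element by blast
    obtain i where "x = g ^ i" using gen \<open>x \<noteq> 0\<close> by blast
    then show ?thesis using g[of "i * (m * n)"] card by (simp add: power_mult)
  qed
  have fm: "?f x ^ m = ?g (x ^ m)" for x by (simp add: power_mult_distrib)
  show ?thesis
  proof (intro iffI conjI)
    assume inj: "inj ?f"
    show nz: ?nz
    proof (intro allI impI notI)
      fix y :: 'a assume "y ^ n = 1" "h y = 0"
      then obtain x where x: "x \<noteq> 0" "y = x ^ m" using surj by blast
      \<comment> \<open>A zero of \<open>h\<close> in \<mu> would give \<open>?f\<close> a second
        root besides 0.\<close>
      then have "?f x = ?f 0" using \<open>h y = 0\<close> by simp
      then show False using inj x(1) by (metis injD)
    qed
    show "inj_on ?g ?\<mu>"
    proof (rule inj_onI)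
      fix y1 y2 assume y: "y1 \<in> ?\<mu>" "y2 \<in> ?\<mu>" and eq: "?g y1 = ?g y2"
      obtain x1 where x1: "x1 \<noteq> 0" "y1 = x1 ^ m" using surj y by blast
      obtain x2 where x2: "x2 \<noteq> 0" "y2 = x2 ^ m" using surj y by blast
      have f2: "?f x2 \<noteq> 0" using nz y x2 by simp
      \<comment> \<open>Equal values of \<open>?g\<close> make this ratio an \<open>m\<close>-th
        root of unity, and scaling by such a \<open>c\<close> commutes with \<open>?f\<close>. Hence
        \<open>c * x2\<close> and \<open>x1\<close> have the same image, and \<open>x1\<close>,
        \<open>x2\<close> lie in one fibre.\<close>
      define c where "c = ?f x1 / ?f x2"
      have "?f x1 ^ m = ?f x2 ^ m" unfolding fm using eq x1 x2 by simp
      then have c: "c ^ m = 1" using f2 by (simp add: c_def power_divide)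
      have "?f (c * x2) = c * ?f x2" using c by (simp add: power_mult_distrib)
      also have "\<dots> = ?f x1" using f2 by (simp add: c_def)
      finally have "c * x2 = x1" by (rule injD[OF inj])
      then show "y1 = y2" using c x1 x2 by (auto simp: power_mult_distrib)
    qed
  next
    assume R: "?nz \<and> inj_on ?g ?\<mu>"
    have nz: "h (x ^ m) \<noteq> 0" if "x \<noteq> 0" for x using R ord[OF that] by blast
    show "inj ?f"
    proof (rule injI)
      fix x1 x2 assume eq: "?f x1 = ?f x2"
      show "x1 = x2"
      proof (cases "x1 = 0 \<or> x2 = 0")
        case True
        then show ?thesis using eq nz by (metis mult_eq_0_iff)
      next
        case False
        have "?g (x1 ^ m) = ?g (x2 ^ m)" using eq fm by metis
        then have "x1 ^ m = x2 ^ m"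
          by (rule inj_onD[OF conjunct2[OF R]]) (use False ord in simp_all)
        then show ?thesis using eq nz[of x2] False by (metis mult_right_cancel)
      qed
    qed
  qed
qed

text \<open>Exponents are natural numbers, so the monomials with exponents \<open>1 - 2 * d\<close>
  and \<open>1 - d\<close> appear as inverses of powers; inversion and nonzero scaling preserve
  injectivity.\<close>

lemma inj_on_times_inverse_power_iff:
  fixes c :: "'a::field"
  assumes "c \<noteq> 0" and "\<And>y. y \<in> A \<Longrightarrow> f y = c * inverse (y ^ k)"
  shows "inj_on f A \<longleftrightarrow> inj_on (\<lambda>y. y ^ k) A"
  using assms by (simp add: inj_on_def)

lemma permutation_poly_iff_inj: "permutation_poly f \<longleftrightarrow> inj (poly f)"
  unfolding permutation_poly_def bij_def using finite_UNIV_inj_surj[of "poly f"] by auto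

text \<open>The characteristic divides the cardinality, a power of the prime below \<open>Q\<close>,
  so it is that prime and \<open>Q\<close> is one of its powers.\<close>

lemma frobenius_square_card:
  fixes x y :: "'a::{field,finite}"
  assumes "primepow Q" and "CARD('a) = Q ^ 2"
  shows "(x + y) ^ Q = x ^ Q + y ^ Q"
proof -
  obtain p k where p: "prime p" "Q = p ^ k" using assms(1) unfolding primepow_def by blast
  have prime: "prime CHAR('a)" by (simp add: finite_imp_CHAR_pos prime_CHAR_semidom)
  have "CHAR('a) dvd p ^ (k * 2)"
    using CHAR_dvd_CARD[where ?'a = 'a] assms(2) p(2) by (simp add: power_mult)
  then have "CHAR('a) = p"
    using prime p(1) by (metis prime_dvd_power primes_dvd_imp_eq)
  then show ?thesis using freshmans_dream'[OF prime] p(2) by metis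
qed

theorem corollary5p2:
  fixes Q d :: nat and \<beta> :: "'a::{field,finite}"
  assumes "primepow Q"
    and "CARD('a) = Q ^ 2"
    and "d > 0"
    and "\<beta> ^ (Q + 1) = 1"
  shows "complete_permutation_poly (monom \<beta> (1 + d * (Q - 1))) \<longleftrightarrow>
    gcd ((d - 1) * (2 * d - 1)) (Q + 1) = 1 \<and>
    (- \<beta>) ^ ((Q + 1) div gcd (Q + 1) d) \<noteq> 1"
proof -
  define n m where "n = Q + 1" and "m = Q - 1"
  have Q: "Q > 1" using primepow_gt_Suc_0[OF assms(1)] by simp
  have Qm: "Q = Suc m" using Q by (simp add: m_def)
  have m: "m > 0" and n: "n > 0" using Q by (simp_all add: m_def n_def)
  have card: "CARD('a) - 1 = m * n"
    unfolding assms(2) n_def Qm by (simp add: power2_eq_square)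
  have dvd: "n dvd CARD('a) - 1" unfolding card by simp
  have \<beta>: "\<beta> ^ n = 1" "\<beta> \<noteq> 0" using assms(4) by (auto simp: n_def power_0_left)
  let ?\<mu> = "{y :: 'a. y ^ n = 1}"
  have frob: "(x + y) ^ Q = x ^ Q + y ^ Q" for x y :: 'a
    using frobenius_square_card[OF assms(1,2)] .
  have nz: "y \<noteq> 0" if "y \<in> ?\<mu>" for y using that n by (auto simp: power_0_left)

  \<comment> \<open>The monomial itself\<close>
  have "permutation_poly (monom \<beta> (1 + d * m)) \<longleftrightarrow> inj (\<lambda>x. x * (\<beta> * (x ^ m) ^ d))"
    unfolding permutation_poly_iff_inj
    by (simp add: poly_monom[abs_def] mult_ac flip: power_mult)
  also have "\<dots> \<longleftrightarrow> (\<forall>y. y ^ n = 1 \<longrightarrow> \<beta> * y ^ d \<noteq> 0) \<and>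
      inj_on (\<lambda>y. y * (\<beta> * y ^ d) ^ m) ?\<mu>"
    by (rule inj_times_power_iff[OF card m n])
  also have "\<dots> \<longleftrightarrow> inj_on (\<lambda>y. y * (\<beta> * y ^ d) ^ m) ?\<mu>"
    using \<beta>(2) nz by auto
  also have "\<dots> \<longleftrightarrow> inj_on (\<lambda>y. y ^ (2 * d - 1)) ?\<mu>"
  proof (rule inj_on_times_inverse_power_iff)
    show "\<beta> ^ m \<noteq> 0" using \<beta>(2) by simp
    fix y :: 'a assume y: "y \<in> ?\<mu>"
    \<comment> \<open>Since \<open>m = n - 2\<close>, the exponent \<open>1 + d * m\<close> is
      \<open>1 - 2 * d\<close> modulo \<open>n\<close>; the truncated subtraction is exact because
      \<open>d > 0\<close>.\<close>
    have "1 + d * m + (2 * d - 1) = n * d"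
      using assms(3) by (simp add: n_def Qm algebra_simps)
    then have "y ^ (1 + d * m) * y ^ (2 * d - 1) = (y ^ n) ^ d"
      by (simp only: power_add[symmetric] power_mult[symmetric])
    then have "y ^ (1 + d * m) * y ^ (2 * d - 1) = 1" using y by simp
    then have "y ^ (1 + d * m) = inverse (y ^ (2 * d - 1))"
      using nz[OF y] by (simp add: field_simps)
    then show "y * (\<beta> * y ^ d) ^ m = \<beta> ^ m * inverse (y ^ (2 * d - 1))"
      by (simp add: power_mult_distrib mult_ac flip: power_mult)
  qed
  also have "\<dots> \<longleftrightarrow> coprime (2 * d - 1) n"
    by (rule inj_on_power_roots_of_unity_iff[OF dvd n])
  finally have perm1: "permutation_poly (monom \<beta> (1 + d * m)) \<longleftrightarrow> coprime (2 * d - 1) n" .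

  \<comment> \<open>Zeros of \<open>\<beta> * y ^ d + 1\<close> among the roots of unity\<close>
  have zero: "(\<forall>y. y ^ n = 1 \<longrightarrow> \<beta> * y ^ d + 1 \<noteq> 0) \<longleftrightarrow> (- \<beta>) ^ (n div gcd n d) \<noteq> 1"
  proof -
    \<comment> \<open>Frobenius applied to \<open>- 1 + 1 = 0\<close> gives
      \<open>(- 1) ^ Q = - 1\<close> without a case split on the parity of \<open>Q\<close>.\<close>
    have "(- 1 :: 'a) ^ Q + 1 ^ Q = 0" unfolding frob[symmetric] using Q by simp
    then have minus1: "(- 1 :: 'a) ^ n = 1"
      by (simp add: n_def add_eq_0_iff2)
    have "(- \<beta>) ^ n = 1"
      using minus1 \<beta>(1) power_mult_distrib[of "- 1" \<beta> n] by simp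
    then have \<mu>: "inverse (- \<beta>) ^ n = 1"
      by (metis inverse_1 power_inverse)
    have "\<beta> * y ^ d + 1 = 0 \<longleftrightarrow> y ^ d = inverse (- \<beta>)" for y
    proof -
      have "\<beta> * y ^ d + 1 = 0 \<longleftrightarrow> - \<beta> * y ^ d = 1" by (auto simp: add_eq_0_iff)
      also have "\<dots> \<longleftrightarrow> y ^ d = inverse (- \<beta>)"
        by (metis \<beta>(2) inverse_unique neg_equal_0_iff_equal right_inverse)
      finally show ?thesis .
    qed
    then have "(\<exists>y. y ^ n = 1 \<and> \<beta> * y ^ d + 1 = 0) \<longleftrightarrow>
        inverse (- \<beta>) ^ (n div gcd n d) = 1"
      using power_root_of_unity_iff[OF dvd n \<mu>, of d] by simp
    also have "\<dots> \<longleftrightarrow> (- \<beta>) ^ (n div gcd n d) = 1"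
      by (metis inverse_1 inverse_inverse_eq power_inverse)
    finally show ?thesis by blast
  qed

  \<comment> \<open>The monomial plus \<open>x\<close>\<close>
  have "permutation_poly (monom \<beta> (1 + d * m) + [:0, 1:]) \<longleftrightarrow>
      inj (\<lambda>x. x * (\<beta> * (x ^ m) ^ d + 1))"
    unfolding permutation_poly_iff_inj poly_add[abs_def]
    by (simp add: poly_monom[abs_def] algebra_simps flip: power_mult)
  also have "\<dots> \<longleftrightarrow> (\<forall>y. y ^ n = 1 \<longrightarrow> \<beta> * y ^ d + 1 \<noteq> 0) \<and>
      inj_on (\<lambda>y. y * (\<beta> * y ^ d + 1) ^ m) ?\<mu>"
    by (rule inj_times_power_iff[OF card m n])
  also have "\<dots> \<longleftrightarrow> (\<forall>y. y ^ n = 1 \<longrightarrow> \<beta> * y ^ d + 1 \<noteq> 0) \<and> coprime (d - 1) n"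
  \<comment> \<open>The absence of zeros is kept as a hypothesis here: it allows a factor
    \<open>u + 1\<close> to be cancelled below.\<close>
  proof (rule conj_cong[OF refl])
    assume h: "\<forall>y. y ^ n = 1 \<longrightarrow> \<beta> * y ^ d + 1 \<noteq> 0"
    have "inj_on (\<lambda>y. y * (\<beta> * y ^ d + 1) ^ m) ?\<mu> \<longleftrightarrow> inj_on (\<lambda>y. y ^ (d - 1)) ?\<mu>"
    proof (rule inj_on_times_inverse_power_iff)
      show "inverse \<beta> \<noteq> 0" using \<beta>(2) by simp
      fix y :: 'a assume y: "y \<in> ?\<mu>"
      define u where "u = \<beta> * y ^ d"
      have "u ^ n = 1" using y \<beta>(1)
        by (simp add: u_def power_mult_distrib power_mult[symmetric] mult.commute[of d n])
          (simp add: power_mult)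
      \<comment> \<open>As \<open>u ^ Q\<close> is the inverse of \<open>u\<close>,
        \<open>(u + 1) ^ Q * u = (u ^ Q + 1) * u = 1 + u\<close>. Cancelling \<open>u + 1\<close>
        shows that \<open>(u + 1) ^ m\<close> is the inverse of \<open>u\<close>, so that
        \<open>y * (u + 1) ^ m\<close> is \<open>y\<close> divided by
        \<open>\<beta> * y ^ d\<close>.\<close>
      then have "u ^ Q * u = 1" by (simp add: n_def mult.commute)
      then have "(u + 1) ^ Q * u = u + 1" by (simp add: frob algebra_simps)
      then have "((u + 1) ^ m * u) * (u + 1) = 1 * (u + 1)" unfolding Qm by (simp add: mult_ac)
      then have "(u + 1) ^ m * u = 1" using h y unfolding u_def by (subst (asm) mult_right_cancel) auto
      moreover have "u = \<beta> * (y * y ^ (d - 1))"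
        using assms(3) by (cases d) (simp_all add: u_def)
      ultimately have "y * (u + 1) ^ m * (\<beta> * y ^ (d - 1)) = 1" by (simp add: mult_ac)
      then show "y * (\<beta> * y ^ d + 1) ^ m = inverse \<beta> * inverse (y ^ (d - 1))"
        unfolding u_def[symmetric] using \<beta>(2) nz[OF y] by (simp add: field_simps)
    qed
    also have "\<dots> \<longleftrightarrow> coprime (d - 1) n"
      by (rule inj_on_power_roots_of_unity_iff[OF dvd n])
    finally show "inj_on (\<lambda>y. y * (\<beta> * y ^ d + 1) ^ m) ?\<mu> \<longleftrightarrow> coprime (d - 1) n" .
  qed
  finally have "permutation_poly (monom \<beta> (1 + d * m) + [:0, 1:]) \<longleftrightarrow>
      (- \<beta>) ^ (n div gcd n d) \<noteq> 1 \<and> coprime (d - 1) n"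
    unfolding zero .
  moreover have "gcd ((d - 1) * (2 * d - 1)) n = 1 \<longleftrightarrow> coprime (d - 1) n \<and> coprime (2 * d - 1) n"
    by (simp only: coprime_iff_gcd_eq_1[symmetric] coprime_mult_left_iff)
  ultimately show ?thesis
    unfolding complete_permutation_poly_def m_def[symmetric] n_def[symmetric] perm1
    by argo
qed

end
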